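(* For all $1/3\le\alpha\le1$, $n\ge1$, $V>0$ and $\sigma>0$, $$\inf_{\tilde\mu}\ \sup_{\mu\in\mathcal F_{n,\alpha,V}}\mathbb E\,\frac1n\|\tilde\mu-\mu\|^2\ \le\ 21\,V\sigma\,\frac{\sqrt{\log(en)}}{n^{(1+\alpha)/2}}+16\,\sigma^2\,\frac{1+\log(en)}{n},$$ where the infimum is over all estimators $\tilde\mu=\tilde\mu(Y)$.
   Context: For $0\le\alpha\le1$ and a positive integer $n$, put $m=\lceil n^\alpha\rceil$ and $l=\lceil n^{1-\alpha}\rceil$. The rooted tree $\mathcal T_{\alpha,n}$ has a root with $m$ children, each of which is the first vertex of a path with $l$ vertices; it has $lm+1=\Theta(n)$ vertices. A flow $\mu$ on it consists of a root value $\mu_1$ and values $\mu^{(j)}_i$ ($1\le j\le m$, $1\le i\le l$) along the paths, satisfying $\mu_1\ge\sum_{j=1}^m\mu^{(j)}_1$ and $\mu^{(j)}_1\ge\mu^{(j)}_2\ge\cdots\ge\mu^{(j)}_l\ge0$ for each $j$. $\mathcal F_{n,\alpha,V}$ is the set of flows on $\mathcal T_{\alpha,n}$ with $\mu_1\le V$. The data are $Y=\mu+\epsilon$ with one independent $N(0,\sigma^2)$ error at each vertex; an estimator is a measurable function of $Y$ with real values at the vertices. $\|\cdot\|$ is the Euclidean norm over all vertices, $e$ inside $\log(en)$ is Euler's number, and $\mathbb E$ is expectation under the true $\mu$. *)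

theory Defs
  imports "HOL-Probability.Probability"
begin

definition num_paths :: "real \<Rightarrow> nat \<Rightarrow> nat" where
  "num_paths \<alpha> n = nat \<lceil>real n powr \<alpha>\<rceil>"

definition path_length :: "real \<Rightarrow> nat \<Rightarrow> nat" where
  "path_length \<alpha> n = nat \<lceil>real n powr (1 - \<alpha>)\<rceil>"

text \<open>\<open>Path j i\<close> is the \<open>i\<close>-th vertex of the \<open>j\<close>-th path, with both indices starting at 1;
  its parent is \<open>Path j (i - 1)\<close> if \<open>i > 1\<close> and \<open>Root\<close> if \<open>i = 1\<close>.\<close>

datatype vertex = Root | Path nat nat

definition vertices :: "real \<Rightarrow> nat \<Rightarrow> vertex set" where
  "vertices \<alpha> n = insert Root {Path j i | j i. j \<in> {1..num_paths \<alpha> n} \<and> i \<in> {1..path_length \<alpha> n}}"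

text \<open>Real vectors indexed by the vertices are represented as extensional functions, so that they
  are exactly the points of the product measurable space over \<open>vertices \<alpha> n\<close>.\<close>

definition flows :: "real \<Rightarrow> nat \<Rightarrow> (vertex \<Rightarrow> real) set" where
  "flows \<alpha> n = {\<mu> \<in> vertices \<alpha> n \<rightarrow>\<^sub>E UNIV.
     (\<Sum>j = 1..num_paths \<alpha> n. \<mu> (Path j 1)) \<le> \<mu> Root \<and>
     (\<forall>j \<in> {1..num_paths \<alpha> n}.
        (\<forall>i \<in> {1..<path_length \<alpha> n}. \<mu> (Path j (i + 1)) \<le> \<mu> (Path j i)) \<and>
        0 \<le> \<mu> (Path j (path_length \<alpha> n)))}"

definition bounded_flows :: "real \<Rightarrow> nat \<Rightarrow> real \<Rightarrow> (vertex \<Rightarrow> real) set" where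
  "bounded_flows \<alpha> n V = {\<mu> \<in> flows \<alpha> n. \<mu> Root \<le> V}"

text \<open>Joint law of the errors. The second parameter of \<open>normal_density\<close> is the standard deviation.\<close>

definition noise :: "real \<Rightarrow> nat \<Rightarrow> real \<Rightarrow> (vertex \<Rightarrow> real) measure" where
  "noise \<alpha> n \<sigma> = PiM (vertices \<alpha> n) (\<lambda>_. density lborel (normal_density 0 \<sigma>))"

definition observation :: "real \<Rightarrow> nat \<Rightarrow> (vertex \<Rightarrow> real) \<Rightarrow> (vertex \<Rightarrow> real) \<Rightarrow> vertex \<Rightarrow> real" where
  "observation \<alpha> n \<mu> \<epsilon> = (\<lambda>v \<in> vertices \<alpha> n. \<mu> v + \<epsilon> v)"

definition estimators :: "real \<Rightarrow> nat \<Rightarrow> ((vertex \<Rightarrow> real) \<Rightarrow> vertex \<Rightarrow> real) set" where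
  "estimators \<alpha> n = measurable (PiM (vertices \<alpha> n) (\<lambda>_. borel)) (PiM (vertices \<alpha> n) (\<lambda>_. borel))"

text \<open>The risk is an extended nonnegative integral: an estimator without second moments has risk
  \<open>\<infinity>\<close>, whereas the Bochner integral would make it 0.\<close>

definition risk ::
  "real \<Rightarrow> nat \<Rightarrow> real \<Rightarrow> ((vertex \<Rightarrow> real) \<Rightarrow> vertex \<Rightarrow> real) \<Rightarrow> (vertex \<Rightarrow> real) \<Rightarrow> ennreal" where
  "risk \<alpha> n \<sigma> T \<mu> =
     (\<integral>\<^sup>+ \<epsilon>. ennreal (1 / real n * (\<Sum>v \<in> vertices \<alpha> n. (T (observation \<alpha> n \<mu> \<epsilon>) v - \<mu> v)\<^sup>2))
       \<partial>noise \<alpha> n \<sigma>)"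

definition minimax_risk :: "real \<Rightarrow> nat \<Rightarrow> real \<Rightarrow> real \<Rightarrow> ennreal" where
  "minimax_risk \<alpha> n V \<sigma> = (INF T \<in> estimators \<alpha> n. SUP \<mu> \<in> bounded_flows \<alpha> n V. risk \<alpha> n \<sigma> T \<mu>)"

end

theory Submission
  imports Defs
begin

text \<open>The estimator is least squares over a finite net of bounded flows, obtained by rounding all
  values down to multiples of a small \<open>\<delta>\<close>. If \<open>p\<close> is the rounding of the true flow \<open>\<mu>\<close>, minimality gives
  \<open>\<parallel>T - \<mu>\<parallel>\<^sup>2 \<le> \<parallel>p - \<mu>\<parallel>\<^sup>2 + 2\<langle>\<epsilon>, T\<rangle> - 2\<langle>\<epsilon>, p\<rangle>\<close>, where the last term has mean 0. By Abel summation
  \<open>\<langle>\<epsilon>, T\<rangle>\<close> is at most \<open>V\<close> times the maximum of 0 and the sums of the errors over the root and an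
  initial segment of a path. This is a maximum of \<open>O(n)\<close> Gaussians of variance at most
  \<open>\<sigma>\<^sup>2 (l + 1)\<close>, so its mean is of order \<open>\<sigma> sqrt (l log (e n))\<close>.\<close>

section \<open>Abel summation and measurable minimisers\<close>

text \<open>By Abel summation the left side is a combination of the partial sums of
  \<open>x\<close>, with the weights \<open>a i - a (i + 1)\<close> and \<open>a l\<close>. These
  are nonnegative and add up to \<open>a 1\<close>.\<close>

lemma sum_mult_antitone_le:
  fixes a x :: "nat \<Rightarrow> real"
  assumes anti: "\<And>i. i \<in> {1..<l} \<Longrightarrow> a (i + 1) \<le> a i"
    and nonneg: "0 \<le> a l" and "1 \<le> l"
    and part: "\<And>i. i \<in> {1..l} \<Longrightarrow> (\<Sum>k = 1..i. x k) \<le> B"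
  shows "(\<Sum>k = 1..l. a k * x k) \<le> a 1 * B"
proof -
  \<comment> \<open>All partial sums but the last are already replaced by \<open>B\<close>. The last
    one stays exact, since the next step splits its weight \<open>a i\<close> into
    \<open>a i - a (Suc i)\<close> and \<open>a (Suc i)\<close>.\<close>
  have "(\<Sum>k = 1..i. a k * x k) \<le> (a 1 - a i) * B + a i * (\<Sum>k = 1..i. x k)"
    if "1 \<le> i" "i \<le> l" for i
    using that
  proof (induction i rule: dec_induct)
    case base
    then show ?case by simp
  next
    case (step i)
    have "(a i - a (Suc i)) * (\<Sum>k = 1..i. x k) \<le> (a i - a (Suc i)) * B"
      using step anti[of i] part[of i] by (intro mult_left_mono) auto
    with step show ?case by (simp add: algebra_simps)
  qed
  from this[of l] have "(\<Sum>k = 1..l. a k * x k) \<le> (a 1 - a l) * B + a l * (\<Sum>k = 1..l. x k)"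
    using \<open>1 \<le> l\<close> by simp
  also have "\<dots> \<le> (a 1 - a l) * B + a l * B"
    using part[of l] nonneg \<open>1 \<le> l\<close> by (intro add_left_mono mult_left_mono) auto
  finally show ?thesis by (simp add: algebra_simps)
qed

lemma measurable_argmin:
  fixes d :: "'g \<Rightarrow> 'a \<Rightarrow> real"
  assumes "finite G" "G \<noteq> {}" "G \<subseteq> space N" "\<And>g. g \<in> G \<Longrightarrow> d g \<in> borel_measurable M"
  shows "\<exists>T \<in> measurable M N. \<forall>y. T y \<in> G \<and> (\<forall>g\<in>G. d (T y) y \<le> d g y)"
proof -
  \<comment> \<open>Candidates are added one at a time. Carrying the measurability of the attained
    minimum through the induction makes the set where the new candidate wins measurable.\<close>
  have "\<exists>T. T \<in> measurable M N \<and> (\<lambda>y. d (T y) y) \<in> borel_measurable M \<and>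
      (\<forall>y. T y \<in> G \<and> (\<forall>g\<in>G. d (T y) y \<le> d g y))"
    using assms
  proof (induction G rule: finite_ne_induct)
    case (singleton g)
    then show ?case by (intro exI[of _ "\<lambda>_. g"]) auto
  next
    case (insert g G)
    have "G \<subseteq> space N" "\<And>h. h \<in> G \<Longrightarrow> d h \<in> borel_measurable M"
      using insert.prems by simp_all
    from insert.IH[OF this] obtain T where T[measurable]: "T \<in> measurable M N" "(\<lambda>y. d (T y) y) \<in> borel_measurable M"
      and min: "\<And>y. T y \<in> G" "\<And>y h. h \<in> G \<Longrightarrow> d (T y) y \<le> d h y"
      by blast
    define T' where "T' = (\<lambda>y. if d g y \<le> d (T y) y then g else T y)"
    have [measurable]: "d g \<in> borel_measurable M"
      using insert.prems(2)[of g] by simp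
    have [measurable]: "(\<lambda>_. g) \<in> measurable M N"
      using insert.prems(1) by (intro measurable_const) simp
    have eq: "(\<lambda>y. d (T' y) y) = (\<lambda>y. min (d g y) (d (T y) y))"
      by (auto simp: T'_def fun_eq_iff)
    have "T' \<in> measurable M N" unfolding T'_def by measurable
    moreover have "(\<lambda>y. d (T' y) y) \<in> borel_measurable M" unfolding eq by measurable
    moreover have "T' y \<in> insert g G" for y using min(1) by (auto simp: T'_def)
    moreover have "d (T' y) y \<le> d h y" if "h \<in> insert g G" for y h
      using that min(2)[of h y] by (auto simp: T'_def)
    ultimately show ?case by blast
  qed
  then show ?thesis by blast
qed

section \<open>Gaussian moments\<close>

text \<open>Completing the square turns the integrand into a constant times the normal density with
  mean \<open>c * \<sigma>\<^sup>2\<close>.\<close>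

lemma has_bochner_integral_normal_exp:
  assumes "\<sigma> > 0"
  shows "has_bochner_integral (density lborel (normal_density 0 \<sigma>)) (\<lambda>x. exp (c * x))
           (exp (c\<^sup>2 * \<sigma>\<^sup>2 / 2))"
proof -
  have eq: "normal_density 0 \<sigma> x *\<^sub>R exp (c * x)
      = exp (c\<^sup>2 * \<sigma>\<^sup>2 / 2) * normal_density (c * \<sigma>\<^sup>2) \<sigma> x" for x
  proof -
    have "- (x - 0)\<^sup>2 / (2 * \<sigma>\<^sup>2) + c * x = c\<^sup>2 * \<sigma>\<^sup>2 / 2 + (- (x - c * \<sigma>\<^sup>2)\<^sup>2 / (2 * \<sigma>\<^sup>2))"
      using assms by (simp add: field_simps power2_eq_square)
    then show ?thesis
      unfolding normal_density_def by (simp add: exp_add[symmetric])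
  qed
  have "has_bochner_integral lborel (\<lambda>x. exp (c\<^sup>2 * \<sigma>\<^sup>2 / 2) * normal_density (c * \<sigma>\<^sup>2) \<sigma> x)
      (exp (c\<^sup>2 * \<sigma>\<^sup>2 / 2) * 1)"
    using assms
    by (intro has_bochner_integral_mult_right)
       (simp add: has_bochner_integral_iff integrable_normal_density integral_normal_density)
  then have "has_bochner_integral lborel (\<lambda>x. normal_density 0 \<sigma> x *\<^sub>R exp (c * x))
      (exp (c\<^sup>2 * \<sigma>\<^sup>2 / 2))"
    by (simp only: eq mult_1_right)
  then show ?thesis
    by (intro has_bochner_integral_density) auto
qed

lemma has_bochner_integral_PiM_normal_exp_sum:
  assumes "\<sigma> > 0" "finite I" "A \<subseteq> I"
  shows "has_bochner_integral (PiM I (\<lambda>_. density lborel (normal_density 0 \<sigma>)))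
           (\<lambda>\<epsilon>. exp (c * (\<Sum>i\<in>A. \<epsilon> i))) (exp (c\<^sup>2 * \<sigma>\<^sup>2 * real (card A) / 2))"
proof -
  interpret prob_space "density lborel (normal_density 0 \<sigma>)"
    using assms by (intro prob_space_normal_density)
  interpret product_sigma_finite "\<lambda>_. density lborel (normal_density 0 \<sigma>)"
    by standard
  \<comment> \<open>Coordinates outside \<open>A\<close> get the factor 1, so that the integrand is
    a product over all of \<open>I\<close> and Fubini factorises it.\<close>
  define f :: "_ \<Rightarrow> real \<Rightarrow> real" where
    "f i = (if i \<in> A then (\<lambda>x. exp (c * x)) else (\<lambda>_. 1))" for i
  have eq: "(\<Prod>i\<in>I. f i (\<epsilon> i)) = exp (c * (\<Sum>i\<in>A. \<epsilon> i))" for \<epsilon>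
  proof -
    have "(\<Prod>i\<in>I. f i (\<epsilon> i)) = (\<Prod>i\<in>A. exp (c * \<epsilon> i))"
      using assms by (intro prod.mono_neutral_cong_right) (auto simp: f_def)
    then show ?thesis
      using assms finite_subset[of A I] by (simp add: exp_sum sum_distrib_left)
  qed
  have f: "integrable (density lborel (normal_density 0 \<sigma>)) (f i)" for i
    using has_bochner_integral_normal_exp[OF \<open>\<sigma> > 0\<close>, of c]
    by (cases "i \<in> A") (auto simp: f_def has_bochner_integral_iff)
  have "(\<Prod>i\<in>I. integral\<^sup>L (density lborel (normal_density 0 \<sigma>)) (f i))
      = (\<Prod>i\<in>I. if i \<in> A then exp (c\<^sup>2 * \<sigma>\<^sup>2 / 2) else 1)"
    using has_bochner_integral_normal_exp[OF \<open>\<sigma> > 0\<close>, of c]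
    by (intro prod.cong) (auto simp: f_def has_bochner_integral_iff prob_space[simplified])
  also have "\<dots> = exp (c\<^sup>2 * \<sigma>\<^sup>2 * real (card A) / 2)"
    using assms by (simp add: prod.If_cases Int_absorb1 exp_of_nat_mult[symmetric] mult.commute)
  finally have "(\<Prod>i\<in>I. integral\<^sup>L (density lborel (normal_density 0 \<sigma>)) (f i))
      = exp (c\<^sup>2 * \<sigma>\<^sup>2 * real (card A) / 2)" .
  with product_integrable_prod[of I f, OF \<open>finite I\<close> f] product_integral_prod[of I f, OF \<open>finite I\<close> f]
  show ?thesis by (simp add: has_bochner_integral_iff eq)
qed

text \<open>The marginal of the product law is the one-dimensional normal law. This centres the
  noise term at the rounded flow, which is deterministic.\<close>

lemma has_bochner_integral_PiM_normal_component:
  assumes "\<sigma> > 0" "finite I" "i \<in> I"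
  shows "has_bochner_integral (PiM I (\<lambda>_. density lborel (normal_density 0 \<sigma>))) (\<lambda>\<epsilon>. \<epsilon> i) 0"
proof -
  let ?N = "density lborel (normal_density 0 \<sigma>)"
  have P: "prob_space ?N" using assms by (intro prob_space_normal_density)
  have distr: "distr (PiM I (\<lambda>_. ?N)) ?N (\<lambda>\<epsilon>. \<epsilon> i) = ?N"
    using assms P by (intro distr_PiM_component) auto
  have "has_bochner_integral ?N (\<lambda>x. x) 0"
    using integrable_normal_moment_nz_1[OF \<open>\<sigma> > 0\<close>, of 0] integral_normal_moment_nz_1[OF \<open>\<sigma> > 0\<close>, of 0]
    by (intro has_bochner_integral_density) (auto simp: has_bochner_integral_iff)
  then have mean: "integrable ?N (\<lambda>x. x)" "integral\<^sup>L ?N (\<lambda>x. x) = 0"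
    by (simp_all only: has_bochner_integral_iff)
  have m: "(\<lambda>\<epsilon>. \<epsilon> i) \<in> measurable (PiM I (\<lambda>_. ?N)) ?N"
    using assms(3) by (rule measurable_component_singleton)
  have b: "(\<lambda>x. x) \<in> borel_measurable ?N" by simp
  show ?thesis
    using integrable_distr_eq[OF m b] integral_distr[OF m b] mean
    unfolding distr has_bochner_integral_iff by (simp only: simp_thms)
qed


section \<open>Two inequalities for the risk bound\<close>

text \<open>A concave function lies below its tangent at \<open>c\<close>. With \<open>c\<close> an
  upper bound for the mean of a random \<open>x\<close>, integrating the right side gives the
  estimate of Jensen's inequality from an affine integrand.\<close>

lemma ln_le_tangent:
  fixes x c :: real
  assumes "0 < x" "0 < c"
  shows "ln x \<le> x / c - 1 + ln c"
  using ln_le_minus_one[of "x / c"] assms by (simp add: ln_div)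

text \<open>The basic inequality of least squares: after expanding both squares around
  \<open>\<mu>\<close>, the terms free of \<open>g\<close> and \<open>p\<close> cancel. The two
  noise terms stay separate because \<open>g\<close> will depend on the noise and \<open>p\<close>
  will not.\<close>

lemma sum_sq_error_le:
  fixes g p \<mu> \<epsilon> y :: "'a \<Rightarrow> real"
  assumes y: "\<And>v. v \<in> A \<Longrightarrow> y v = \<mu> v + \<epsilon> v"
    and le: "(\<Sum>v\<in>A. (y v - g v)\<^sup>2) \<le> (\<Sum>v\<in>A. (y v - p v)\<^sup>2)"
  shows "(\<Sum>v\<in>A. (g v - \<mu> v)\<^sup>2)
      \<le> (\<Sum>v\<in>A. (p v - \<mu> v)\<^sup>2) + 2 * (\<Sum>v\<in>A. \<epsilon> v * g v) - 2 * (\<Sum>v\<in>A. \<epsilon> v * p v)"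
proof -
  have "(\<Sum>v\<in>A. (y v - f v)\<^sup>2) = (\<Sum>v\<in>A. (f v - \<mu> v)\<^sup>2) - 2 * (\<Sum>v\<in>A. \<epsilon> v * f v)
      + (\<Sum>v\<in>A. 2 * \<epsilon> v * \<mu> v + (\<epsilon> v)\<^sup>2)" for f
    by (simp add: sum_distrib_left sum.distrib[symmetric] sum_subtractf[symmetric])
       (intro sum.cong refl, simp add: y power2_eq_square algebra_simps)
  from this[of g] this[of p] le show ?thesis by linarith
qed

section \<open>The tree and the range of its flows\<close>

lemma vertices_eq:
  "vertices \<alpha> n
    = insert Root ((\<lambda>(j, i). Path j i) ` ({1..num_paths \<alpha> n} \<times> {1..path_length \<alpha> n}))"
  by (auto simp: vertices_def)

lemma finite_vertices [simp]: "finite (vertices \<alpha> n)"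
  by (simp add: vertices_eq)

lemma sum_vertices:
  fixes f :: "vertex \<Rightarrow> real"
  shows "(\<Sum>v\<in>vertices \<alpha> n. f v)
    = f Root + (\<Sum>j = 1..num_paths \<alpha> n. \<Sum>i = 1..path_length \<alpha> n. f (Path j i))"
proof -
  have inj: "inj_on (\<lambda>(j, i). Path j i) X" for X
    by (auto simp: inj_on_def)
  show ?thesis
    unfolding vertices_eq sum.cartesian_product
    by (subst sum.insert) (auto simp: sum.reindex[OF inj] intro!: sum.cong)
qed

lemma num_paths_pos: "1 \<le> n \<Longrightarrow> 1 \<le> num_paths \<alpha> n"
  by (simp add: num_paths_def Suc_le_eq)

lemma path_length_pos: "1 \<le> n \<Longrightarrow> 1 \<le> path_length \<alpha> n"
  by (simp add: path_length_def Suc_le_eq)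

lemma flows_path_mono:
  assumes "\<mu> \<in> flows \<alpha> n" "j \<in> {1..num_paths \<alpha> n}" "1 \<le> i" "i \<le> k" "k \<le> path_length \<alpha> n"
  shows "\<mu> (Path j k) \<le> \<mu> (Path j i)"
  using \<open>i \<le> k\<close> assms(5)
proof (induction k rule: dec_induct)
  case (step k)
  have "\<mu> (Path j (k + 1)) \<le> \<mu> (Path j k)"
    using assms step by (auto simp: flows_def)
  with step show ?case by simp
qed simp

lemma flows_path_nonneg:
  assumes "\<mu> \<in> flows \<alpha> n" "j \<in> {1..num_paths \<alpha> n}" "i \<in> {1..path_length \<alpha> n}"
  shows "0 \<le> \<mu> (Path j i)"
proof -
  have "0 \<le> \<mu> (Path j (path_length \<alpha> n))" using assms by (auto simp: flows_def)
  also have "\<dots> \<le> \<mu> (Path j i)" using assms by (intro flows_path_mono) auto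
  finally show ?thesis .
qed

text \<open>A path value is at most the first value of its path, which is one summand of a
  nonnegative sum bounded by the root value.\<close>

lemma bounded_flows_bounds:
  assumes \<mu>: "\<mu> \<in> bounded_flows \<alpha> n V" and "1 \<le> n" and "v \<in> vertices \<alpha> n"
  shows "0 \<le> \<mu> v" "\<mu> v \<le> V"
proof -
  have fl: "\<mu> \<in> flows \<alpha> n" and V: "\<mu> Root \<le> V" using \<mu> by (auto simp: bounded_flows_def)
  have sum: "(\<Sum>j = 1..num_paths \<alpha> n. \<mu> (Path j 1)) \<le> \<mu> Root" using fl by (simp add: flows_def)
  have nonneg: "0 \<le> \<mu> (Path j 1)" if "j \<in> {1..num_paths \<alpha> n}" for j
    using flows_path_nonneg[OF fl that] path_length_pos[OF \<open>1 \<le> n\<close>] by auto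
  have "0 \<le> (\<Sum>j = 1..num_paths \<alpha> n. \<mu> (Path j 1))" using nonneg by (intro sum_nonneg)
  then have root: "0 \<le> \<mu> Root" using sum by linarith
  have "0 \<le> \<mu> v \<and> \<mu> v \<le> V"
  proof (cases v)
    case Root
    then show ?thesis using root V by simp
  next
    case (Path j i)
    with assms have ji: "j \<in> {1..num_paths \<alpha> n}" "i \<in> {1..path_length \<alpha> n}"
      by (auto simp: vertices_def)
    have "\<mu> (Path j i) \<le> \<mu> (Path j 1)" using ji by (intro flows_path_mono[OF fl]) auto
    also have "\<dots> \<le> (\<Sum>j = 1..num_paths \<alpha> n. \<mu> (Path j 1))"
      using ji nonneg by (intro member_le_sum) auto
    finally show ?thesis using Path sum V flows_path_nonneg[OF fl ji] by simp
  qed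
  then show "0 \<le> \<mu> v" "\<mu> v \<le> V" by auto
qed

section \<open>Linear functionals on bounded flows\<close>

text \<open>The case \<open>i = 0\<close> is allowed and gives the root alone, the support of a flow
  that sends nothing into the paths.\<close>

definition path_prefix :: "nat \<Rightarrow> nat \<Rightarrow> vertex set" where
  "path_prefix j i = insert Root (Path j ` {1..i})"

lemma card_path_prefix: "card (path_prefix j i) = i + 1"
  unfolding path_prefix_def
  by (subst card_insert_disjoint) (auto simp: card_image inj_on_def)

lemma sum_path_prefix:
  fixes f :: "vertex \<Rightarrow> real"
  shows "(\<Sum>v\<in>path_prefix j i. f v) = f Root + (\<Sum>k = 1..i. f (Path j k))"
  unfolding path_prefix_def
  by (subst sum.insert) (auto simp: sum.reindex inj_on_def)

lemma path_prefix_subset: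
  "j \<in> {1..num_paths \<alpha> n} \<Longrightarrow> i \<le> path_length \<alpha> n \<Longrightarrow> path_prefix j i \<subseteq> vertices \<alpha> n"
  by (auto simp: path_prefix_def vertices_def)

text \<open>The bounded flows are the convex hull of 0 and of \<open>V\<close> times the indicators of the path
  prefixes, so a linear functional is maximal at one of these points.\<close>

lemma bounded_flows_inner_le:
  assumes \<mu>: "\<mu> \<in> bounded_flows \<alpha> n V" and "1 \<le> n" and "0 \<le> t"
    and t: "\<And>j i. j \<in> {1..num_paths \<alpha> n} \<Longrightarrow> i \<le> path_length \<alpha> n
              \<Longrightarrow> (\<Sum>v\<in>path_prefix j i. \<epsilon> v) \<le> t"
  shows "(\<Sum>v\<in>vertices \<alpha> n. \<epsilon> v * \<mu> v) \<le> V * t"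
proof -
  have fl: "\<mu> \<in> flows \<alpha> n" and V: "\<mu> Root \<le> V" using \<mu> by (auto simp: bounded_flows_def)
  \<comment> \<open>The empty initial segment makes \<open>t - \<epsilon> Root\<close> nonnegative,
    so the sum of the first path values can later be enlarged to \<open>\<mu> Root\<close>.\<close>
  from t[of 1 0] num_paths_pos[OF \<open>1 \<le> n\<close>, of \<alpha>] have root: "\<epsilon> Root \<le> t" by (simp add: sum_path_prefix)
  have "(\<Sum>i = 1..path_length \<alpha> n. \<mu> (Path j i) * \<epsilon> (Path j i)) \<le> \<mu> (Path j 1) * (t - \<epsilon> Root)"
    if j: "j \<in> {1..num_paths \<alpha> n}" for j
  proof (rule sum_mult_antitone_le)
    show "\<mu> (Path j (i + 1)) \<le> \<mu> (Path j i)" if "i \<in> {1..<path_length \<alpha> n}" for i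
      using fl j that by (auto simp: flows_def)
    show "0 \<le> \<mu> (Path j (path_length \<alpha> n))" using fl j by (auto simp: flows_def)
    show "(\<Sum>k = 1..i. \<epsilon> (Path j k)) \<le> t - \<epsilon> Root" if "i \<in> {1..path_length \<alpha> n}" for i
      using t[OF j, of i] that by (simp add: sum_path_prefix)
  qed (rule path_length_pos[OF \<open>1 \<le> n\<close>])
  then have "(\<Sum>v\<in>vertices \<alpha> n. \<epsilon> v * \<mu> v)
      \<le> \<epsilon> Root * \<mu> Root + (\<Sum>j = 1..num_paths \<alpha> n. \<mu> (Path j 1) * (t - \<epsilon> Root))"
    unfolding sum_vertices by (intro add_left_mono sum_mono) (simp add: mult.commute)
  also have "\<dots> = \<epsilon> Root * \<mu> Root + (\<Sum>j = 1..num_paths \<alpha> n. \<mu> (Path j 1)) * (t - \<epsilon> Root)"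
    by (simp add: sum_distrib_right)
  also have "\<dots> \<le> \<epsilon> Root * \<mu> Root + \<mu> Root * (t - \<epsilon> Root)"
    using root fl by (intro add_left_mono mult_right_mono) (auto simp: flows_def)
  also have "\<dots> = \<mu> Root * t" by (simp add: algebra_simps)
  also have "\<dots> \<le> V * t" using V \<open>0 \<le> t\<close> by (intro mult_right_mono)
  finally show ?thesis .
qed

section \<open>Rounding to a finite net\<close>

definition round_down :: "real \<Rightarrow> nat \<Rightarrow> real \<Rightarrow> (vertex \<Rightarrow> real) \<Rightarrow> vertex \<Rightarrow> real" where
  "round_down \<alpha> n \<delta> \<mu> = (\<lambda>v\<in>vertices \<alpha> n. \<delta> * of_int \<lfloor>\<mu> v / \<delta>\<rfloor>)"

lemma mult_floor_divide_le:
  fixes x \<delta> :: real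
  assumes "0 < \<delta>"
  shows "\<delta> * of_int \<lfloor>x / \<delta>\<rfloor> \<le> x"
  using of_int_floor_le[of "x / \<delta>"] unfolding pos_le_divide_eq[OF assms] by (simp only: mult.commute)

text \<open>Rounding down keeps the inequality at the root: a sum of integers below \<open>x\<close> is below
  \<open>\<lfloor>x\<rfloor>\<close>.\<close>

lemma round_down_bounded_flows:
  assumes \<mu>: "\<mu> \<in> bounded_flows \<alpha> n V" and "1 \<le> n" and "0 < \<delta>"
  shows "round_down \<alpha> n \<delta> \<mu> \<in> bounded_flows \<alpha> n V"
proof -
  let ?r = "round_down \<alpha> n \<delta> \<mu>" and ?m = "num_paths \<alpha> n" and ?l = "path_length \<alpha> n"
  have fl: "\<mu> \<in> flows \<alpha> n" and V: "\<mu> Root \<le> V" using \<mu> by (auto simp: bounded_flows_def)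
  have l: "1 \<le> ?l" by (rule path_length_pos[OF \<open>1 \<le> n\<close>])
  have r_root: "?r Root = \<delta> * of_int \<lfloor>\<mu> Root / \<delta>\<rfloor>"
    by (simp add: round_down_def vertices_def)
  have r_path: "?r (Path j i) = \<delta> * of_int \<lfloor>\<mu> (Path j i) / \<delta>\<rfloor>"
    if "j \<in> {1..?m}" "i \<in> {1..?l}" for i j
    using that by (auto simp: round_down_def vertices_def)
  have "of_int (\<Sum>j = 1..?m. \<lfloor>\<mu> (Path j 1) / \<delta>\<rfloor>) \<le> (\<Sum>j = 1..?m. \<mu> (Path j 1) / \<delta>)"
    unfolding of_int_sum by (intro sum_mono of_int_floor_le)
  also have "\<dots> = (\<Sum>j = 1..?m. \<mu> (Path j 1)) / \<delta>" by (rule sum_divide_distrib[symmetric])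
  also have "\<dots> \<le> \<mu> Root / \<delta>"
    using fl \<open>0 < \<delta>\<close> by (intro divide_right_mono) (auto simp: flows_def)
  finally have "(\<Sum>j = 1..?m. \<lfloor>\<mu> (Path j 1) / \<delta>\<rfloor>) \<le> \<lfloor>\<mu> Root / \<delta>\<rfloor>"
    by (simp add: le_floor_iff)
  then have "real_of_int (\<Sum>j = 1..?m. \<lfloor>\<mu> (Path j 1) / \<delta>\<rfloor>) \<le> of_int \<lfloor>\<mu> Root / \<delta>\<rfloor>"
    by (rule of_int_le_iff[THEN iffD2])
  then have "\<delta> * (\<Sum>j = 1..?m. of_int \<lfloor>\<mu> (Path j 1) / \<delta>\<rfloor>) \<le> \<delta> * of_int \<lfloor>\<mu> Root / \<delta>\<rfloor>"
    using \<open>0 < \<delta>\<close> by (intro mult_left_mono) auto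
  then have "(\<Sum>j = 1..?m. ?r (Path j 1)) \<le> ?r Root"
    using l by (simp add: r_root r_path sum_distrib_left)
  moreover have "?r (Path j (i + 1)) \<le> ?r (Path j i)" if "j \<in> {1..?m}" "i \<in> {1..<?l}" for i j
  proof -
    have "\<mu> (Path j (i + 1)) \<le> \<mu> (Path j i)" using fl that by (auto simp: flows_def)
    then have "\<lfloor>\<mu> (Path j (i + 1)) / \<delta>\<rfloor> \<le> \<lfloor>\<mu> (Path j i) / \<delta>\<rfloor>"
      using \<open>0 < \<delta>\<close> by (intro floor_mono divide_right_mono) auto
    then show ?thesis using that \<open>0 < \<delta>\<close> by (simp add: r_path)
  qed
  moreover have "0 \<le> ?r (Path j ?l)" if "j \<in> {1..?m}" for j
    using that l \<open>0 < \<delta>\<close> flows_path_nonneg[OF fl that, of ?l] by (simp add: r_path)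
  moreover have "?r Root \<le> V" using mult_floor_divide_le[OF \<open>0 < \<delta>\<close>, of "\<mu> Root"] V r_root by simp
  ultimately show ?thesis
    by (auto simp: bounded_flows_def flows_def round_down_def)
qed

lemma round_down_error:
  assumes "0 < \<delta>" "v \<in> vertices \<alpha> n"
  shows "(round_down \<alpha> n \<delta> \<mu> v - \<mu> v)\<^sup>2 \<le> \<delta>\<^sup>2"
proof -
  have "\<mu> v / \<delta> \<le> of_int \<lfloor>\<mu> v / \<delta>\<rfloor> + 1" by linarith
  then have "\<mu> v \<le> \<delta> * of_int \<lfloor>\<mu> v / \<delta>\<rfloor> + \<delta>"
    unfolding pos_divide_le_eq[OF \<open>0 < \<delta>\<close>] by (simp add: algebra_simps)
  then have "\<bar>round_down \<alpha> n \<delta> \<mu> v - \<mu> v\<bar> \<le> \<bar>\<delta>\<bar>"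
    using assms mult_floor_divide_le[OF \<open>0 < \<delta>\<close>, of "\<mu> v"]
    by (simp add: round_down_def abs_le_iff)
  then show ?thesis by (rule abs_le_square_iff[THEN iffD1])
qed

text \<open>Flow values lie between 0 and \<open>V\<close>, which leaves finitely many multiples of
  \<open>\<delta>\<close> per vertex. \<open>measurable_argmin\<close> needs this
  finiteness.\<close>

lemma finite_round_down_image:
  assumes "1 \<le> n" "0 < \<delta>"
  shows "finite (round_down \<alpha> n \<delta> ` bounded_flows \<alpha> n V)"
proof (rule finite_subset)
  show "round_down \<alpha> n \<delta> ` bounded_flows \<alpha> n V
      \<subseteq> vertices \<alpha> n \<rightarrow>\<^sub>E (\<lambda>k. \<delta> * of_int k) ` {0..\<lfloor>V / \<delta>\<rfloor>}"
  proof (intro image_subsetI PiE_I)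
    fix \<mu> v assume "\<mu> \<in> bounded_flows \<alpha> n V" and v: "v \<in> vertices \<alpha> n"
    then have "0 \<le> \<mu> v / \<delta>" "\<mu> v / \<delta> \<le> V / \<delta>"
      using bounded_flows_bounds[OF _ \<open>1 \<le> n\<close> v] \<open>0 < \<delta>\<close> by (auto intro: divide_right_mono)
    then have "\<lfloor>\<mu> v / \<delta>\<rfloor> \<in> {0..\<lfloor>V / \<delta>\<rfloor>}" by (auto intro: floor_mono)
    then show "round_down \<alpha> n \<delta> \<mu> v \<in> (\<lambda>k. \<delta> * of_int k) ` {0..\<lfloor>V / \<delta>\<rfloor>}"
      using v by (auto simp: round_down_def)
  qed (simp add: round_down_def)
qed (simp add: finite_PiE)


section \<open>Risk of least squares over the net\<close>

text \<open>The maximum of the prefix sums is bounded by the soft maximum \<open>ln S / c\<close>.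
  The parameter \<open>c\<close> trades the logarithm of the number of prefixes against the Gaussian
  exponent of the longest one.\<close>

lemma risk_le:
  assumes "1 \<le> n" "0 < V" "0 < \<sigma>" "0 < c" "0 < \<delta>" and \<mu>: "\<mu> \<in> bounded_flows \<alpha> n V"
    and T: "\<And>y. T y \<in> bounded_flows \<alpha> n V"
    and min: "\<And>y. (\<Sum>v\<in>vertices \<alpha> n. (y v - T y v)\<^sup>2)
               \<le> (\<Sum>v\<in>vertices \<alpha> n. (y v - round_down \<alpha> n \<delta> \<mu> v)\<^sup>2)"
  shows "risk \<alpha> n \<sigma> T \<mu> \<le> ennreal ((real (card (vertices \<alpha> n)) * \<delta>\<^sup>2
      + 2 * V * ((ln (1 + real (num_paths \<alpha> n * (path_length \<alpha> n + 1)))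
          + c\<^sup>2 * \<sigma>\<^sup>2 * real (path_length \<alpha> n + 1) / 2) / c)) / real n)"
proof -
  let ?m = "num_paths \<alpha> n" and ?l = "path_length \<alpha> n" and ?A = "vertices \<alpha> n"
  let ?p = "round_down \<alpha> n \<delta> \<mu>"
  define J where "J = {1..?m} \<times> {..?l}"
  \<comment> \<open>The summand 1 is \<open>exp 0\<close>: it puts 0 among the maximised values, so
    that \<open>ln (S \<epsilon>) / c\<close> is nonnegative. \<open>E\<close> is the exact mean of
    \<open>S\<close>, and \<open>D\<close> bounds \<open>E\<close> by a product whose logarithm
    splits.\<close>
  define S where "S \<epsilon> = 1 + (\<Sum>(j, i)\<in>J. exp (c * (\<Sum>v\<in>path_prefix j i. \<epsilon> v)))" for \<epsilon> :: "vertex \<Rightarrow> real"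
  define E where "E = 1 + (\<Sum>(j, i)\<in>J. exp (c\<^sup>2 * \<sigma>\<^sup>2 * real (card (path_prefix j i)) / 2))"
  define D where "D = (1 + real (?m * (?l + 1))) * exp (c\<^sup>2 * \<sigma>\<^sup>2 * real (?l + 1) / 2)"
  \<comment> \<open>A majorant of the loss that is affine in \<open>S \<epsilon>\<close> and
    \<open>\<epsilon>\<close>, so its mean can be computed exactly.\<close>
  define h where "h \<epsilon> = (real (card ?A) * \<delta>\<^sup>2 + 2 * (V * ((S \<epsilon> / D - 1 + ln D) / c))
      - 2 * (\<Sum>v\<in>?A. \<epsilon> v * ?p v)) / real n" for \<epsilon>
  have "prob_space (noise \<alpha> n \<sigma>)"
    unfolding noise_def using \<open>0 < \<sigma>\<close> by (intro prob_space_PiM prob_space_normal_density)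
  then interpret prob_space "noise \<alpha> n \<sigma>" .
  have one: "has_bochner_integral (noise \<alpha> n \<sigma>) (\<lambda>_. x) x" for x :: real
    by (simp add: has_bochner_integral_iff prob_space)
  have "finite J" by (simp add: J_def)
  have "0 < D" by (simp add: D_def add_pos_nonneg)
  have S_ge: "1 \<le> S \<epsilon>" for \<epsilon> by (auto simp: S_def intro!: sum_nonneg)
  \<comment> \<open>This absorbs the leading 1 of \<open>E\<close> into the product form of
    \<open>D\<close>.\<close>
  have pos: "1 \<le> exp (c\<^sup>2 * \<sigma>\<^sup>2 * real (?l + 1) / 2)" by simp
  have "E \<le> 1 + (\<Sum>(j, i)\<in>J. exp (c\<^sup>2 * \<sigma>\<^sup>2 * real (?l + 1) / 2))"
    unfolding E_def
    by (intro add_left_mono sum_mono)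
       (auto simp: J_def card_path_prefix intro!: divide_right_mono mult_left_mono)
  also have "\<dots> = 1 + real (?m * (?l + 1)) * exp (c\<^sup>2 * \<sigma>\<^sup>2 * real (?l + 1) / 2)"
    by (simp add: J_def card_cartesian_product)
  also have "\<dots> \<le> D" using pos by (simp add: D_def algebra_simps)
  finally have "E \<le> D" .
  have S: "has_bochner_integral (noise \<alpha> n \<sigma>) S E"
    unfolding S_def E_def
  proof (intro has_bochner_integral_add one has_bochner_integral_sum)
    fix k assume "k \<in> J"
    then show "has_bochner_integral (noise \<alpha> n \<sigma>)
        (\<lambda>\<epsilon>. case k of (j, i) \<Rightarrow> exp (c * (\<Sum>v\<in>path_prefix j i. \<epsilon> v)))
        (case k of (j, i) \<Rightarrow> exp (c\<^sup>2 * \<sigma>\<^sup>2 * real (card (path_prefix j i)) / 2))"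
      unfolding noise_def using \<open>0 < \<sigma>\<close> path_prefix_subset[of _ \<alpha> n]
      by (cases k) (simp add: J_def has_bochner_integral_PiM_normal_exp_sum)
  qed
  have "has_bochner_integral (noise \<alpha> n \<sigma>) (\<lambda>\<epsilon>. \<Sum>v\<in>?A. \<epsilon> v * ?p v) (\<Sum>v\<in>?A. 0 * ?p v)"
    unfolding noise_def using \<open>0 < \<sigma>\<close>
    by (intro has_bochner_integral_sum has_bochner_integral_mult_left
        has_bochner_integral_PiM_normal_component) auto
  then have h_int: "has_bochner_integral (noise \<alpha> n \<sigma>) h
      ((real (card ?A) * \<delta>\<^sup>2 + 2 * (V * ((E / D - 1 + ln D) / c)) - 2 * (\<Sum>v\<in>?A. 0 * ?p v)) / real n)"
    unfolding h_def
    by (intro has_bochner_integral_divide has_bochner_integral_add has_bochner_integral_diff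
        has_bochner_integral_mult_right one S impI)
  have le: "1 / real n * (\<Sum>v\<in>?A. (T (observation \<alpha> n \<mu> \<epsilon>) v - \<mu> v)\<^sup>2) \<le> h \<epsilon>" for \<epsilon>
  proof -
    let ?y = "observation \<alpha> n \<mu> \<epsilon>"
    define t where "t = ln (S \<epsilon>) / c"
    have "(\<Sum>v\<in>path_prefix j i. \<epsilon> v) \<le> t" if "j \<in> {1..?m}" "i \<le> ?l" for j i
    proof -
      have "(\<lambda>(j, i). exp (c * (\<Sum>v\<in>path_prefix j i. \<epsilon> v))) (j, i)
          \<le> (\<Sum>(j, i)\<in>J. exp (c * (\<Sum>v\<in>path_prefix j i. \<epsilon> v)))"
        using that \<open>finite J\<close> by (intro member_le_sum) (auto simp: J_def)
      then have "exp (c * (\<Sum>v\<in>path_prefix j i. \<epsilon> v)) \<le> S \<epsilon>"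
        by (simp add: S_def)
      then have "c * (\<Sum>v\<in>path_prefix j i. \<epsilon> v) \<le> ln (S \<epsilon>)"
        using S_ge[of \<epsilon>] by (subst ln_ge_iff) auto
      then show ?thesis using \<open>0 < c\<close> by (simp add: t_def pos_le_divide_eq mult.commute)
    qed
    moreover have "0 \<le> t" using S_ge[of \<epsilon>] \<open>0 < c\<close> by (simp add: t_def)
    ultimately have "(\<Sum>v\<in>?A. \<epsilon> v * T ?y v) \<le> V * t"
      using T \<open>1 \<le> n\<close> by (intro bounded_flows_inner_le)
    also have "t \<le> (S \<epsilon> / D - 1 + ln D) / c"
      unfolding t_def using S_ge[of \<epsilon>] \<open>0 < D\<close> \<open>0 < c\<close>
      by (intro divide_right_mono ln_le_tangent) auto
    finally have inner: "(\<Sum>v\<in>?A. \<epsilon> v * T ?y v) \<le> V * ((S \<epsilon> / D - 1 + ln D) / c)"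
      using \<open>0 < V\<close> by simp
    have "(\<Sum>v\<in>?A. (T ?y v - \<mu> v)\<^sup>2)
        \<le> (\<Sum>v\<in>?A. (?p v - \<mu> v)\<^sup>2) + 2 * (\<Sum>v\<in>?A. \<epsilon> v * T ?y v) - 2 * (\<Sum>v\<in>?A. \<epsilon> v * ?p v)"
      using min[of ?y] by (intro sum_sq_error_le[of _ ?y]) (auto simp: observation_def)
    moreover have "(\<Sum>v\<in>?A. (?p v - \<mu> v)\<^sup>2) \<le> (\<Sum>v\<in>?A. \<delta>\<^sup>2)"
      using \<open>0 < \<delta>\<close> by (intro sum_mono round_down_error)
    ultimately have "(\<Sum>v\<in>?A. (T ?y v - \<mu> v)\<^sup>2) \<le> real (card ?A) * \<delta>\<^sup>2
        + 2 * (V * ((S \<epsilon> / D - 1 + ln D) / c)) - 2 * (\<Sum>v\<in>?A. \<epsilon> v * ?p v)"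
      using inner by simp
    then show ?thesis unfolding h_def by (simp add: divide_right_mono)
  qed
  \<comment> \<open>\<open>h\<close> dominates a sum of squares, so its extended integral is its
    Bochner integral.\<close>
  have nonneg: "0 \<le> h \<epsilon>" for \<epsilon>
    using le[of \<epsilon>] by (rule order_trans[rotated]) (simp add: sum_nonneg)
  have "risk \<alpha> n \<sigma> T \<mu> \<le> (\<integral>\<^sup>+ \<epsilon>. ennreal (h \<epsilon>) \<partial>noise \<alpha> n \<sigma>)"
    unfolding risk_def by (intro nn_integral_mono ennreal_leI le)
  also have "\<dots> = ennreal ((real (card ?A) * \<delta>\<^sup>2 + 2 * (V * ((E / D - 1 + ln D) / c))) / real n)"
    using h_int nonneg by (subst nn_integral_eq_integral) (auto simp: has_bochner_integral_iff)
  \<comment> \<open>Since \<open>E \<le> D\<close>, the tangent remainder \<open>E / D - 1\<close>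
    is at most 0.\<close>
  also have "\<dots> \<le> ennreal ((real (card ?A) * \<delta>\<^sup>2 + 2 * (V * (ln D / c))) / real n)"
    using \<open>E \<le> D\<close> \<open>0 < D\<close> \<open>0 < c\<close> \<open>0 < V\<close>
    by (intro ennreal_leI divide_right_mono add_left_mono mult_left_mono) auto
  also have "ln D = ln (1 + real (?m * (?l + 1))) + c\<^sup>2 * \<sigma>\<^sup>2 * real (?l + 1) / 2"
    unfolding D_def by (subst ln_mult) (auto simp: add_pos_nonneg simp del: of_nat_add of_nat_mult)
  finally show ?thesis by (simp only: mult.assoc)
qed

lemma minimax_risk_le:
  assumes "1 \<le> n" "0 < V" "0 < \<sigma>" "0 < c" "0 < \<delta>"
  shows "minimax_risk \<alpha> n V \<sigma> \<le> ennreal ((real (card (vertices \<alpha> n)) * \<delta>\<^sup>2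
      + 2 * V * ((ln (1 + real (num_paths \<alpha> n * (path_length \<alpha> n + 1)))
          + c\<^sup>2 * \<sigma>\<^sup>2 * real (path_length \<alpha> n + 1) / 2) / c)) / real n)" (is "_ \<le> ?B")
proof (cases "bounded_flows \<alpha> n V = {}")
  \<comment> \<open>The minimiser requires a nonempty net. A supremum over no flows is
    \<open>bot\<close>, which is 0 in \<open>ennreal\<close>, so a constant estimator suffices
    here.\<close>
  case True
  have "(\<lambda>_. \<lambda>v\<in>vertices \<alpha> n. 0) \<in> estimators \<alpha> n"
    unfolding estimators_def by (intro measurable_const) (auto simp: space_PiM)
  then have "minimax_risk \<alpha> n V \<sigma> \<le> 0"
    unfolding minimax_risk_def by (rule INF_lower2) (simp add: True bot_ennreal)
  then show ?thesis by (simp only: le_zero_eq zero_le)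
next
  case False
  \<comment> \<open>The net does not depend on the true flow, so one estimator serves all flows;
    each flow is compared with its own rounding in the net.\<close>
  let ?G = "round_down \<alpha> n \<delta> ` bounded_flows \<alpha> n V"
  have G: "?G \<subseteq> bounded_flows \<alpha> n V"
    using round_down_bounded_flows assms by blast
  let ?P = "PiM (vertices \<alpha> n) (\<lambda>_. borel :: real measure)"
  have fin: "finite ?G" using assms by (intro finite_round_down_image)
  have ne: "?G \<noteq> {}" using False by simp
  have sub: "?G \<subseteq> space ?P" by (auto simp: space_PiM round_down_def)
  have meas: "(\<lambda>y. \<Sum>v\<in>vertices \<alpha> n. (y v - g v)\<^sup>2) \<in> borel_measurable ?P" for g
    by measurable
  from measurable_argmin[where d = "\<lambda>g y. \<Sum>v\<in>vertices \<alpha> n. (y v - g v)\<^sup>2",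
      OF fin ne sub meas]
  obtain T where T: "T \<in> measurable ?P ?P" and T_net: "\<And>y. T y \<in> ?G"
    and T_min: "\<And>y g. g \<in> ?G \<Longrightarrow>
      (\<Sum>v\<in>vertices \<alpha> n. (y v - T y v)\<^sup>2) \<le> (\<Sum>v\<in>vertices \<alpha> n. (y v - g v)\<^sup>2)"
    by blast
  have "minimax_risk \<alpha> n V \<sigma> \<le> (SUP \<mu> \<in> bounded_flows \<alpha> n V. risk \<alpha> n \<sigma> T \<mu>)"
    unfolding minimax_risk_def using T by (intro INF_lower) (simp add: estimators_def)
  also have "\<dots> \<le> ?B"
  proof (rule SUP_least)
    fix \<mu> assume \<mu>: "\<mu> \<in> bounded_flows \<alpha> n V"
    show "risk \<alpha> n \<sigma> T \<mu> \<le> ?B"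
      using assms \<mu> subsetD[OF G T_net] T_min[OF imageI[OF \<mu>]] by (rule risk_le)
  qed
  finally show ?thesis .
qed

section \<open>Choice of the parameters\<close>

theorem theorem2p11:
  fixes \<alpha> V \<sigma> :: real and n :: nat
  assumes "1 / 3 \<le> \<alpha>" and "\<alpha> \<le> 1" and "n \<ge> 1" and "V > 0" and "\<sigma> > 0"
  shows "minimax_risk \<alpha> n V \<sigma> \<le>
    ennreal (21 * V * \<sigma> * (sqrt (ln (exp 1 * real n)) / real n powr ((1 + \<alpha>) / 2))
      + 16 * \<sigma>\<^sup>2 * ((1 + ln (exp 1 * real n)) / real n))"
proof -
  define L where "L = ln (exp 1 * real n)"
  define q where "q = real n powr (1 - \<alpha>)"
  \<comment> \<open>With path length of order \<open>q\<close>, this choice makes the logarithmic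
    term and the variance term both of order \<open>L\<close>.\<close>
  define c where "c = sqrt (L / q) / \<sigma>"
  define k where "k = real (card (vertices \<alpha> n))"
  \<comment> \<open>The total rounding error \<open>k * \<delta>\<^sup>2\<close> becomes
    \<open>\<sigma>\<^sup>2\<close>.\<close>
  define \<delta> where "\<delta> = \<sigma> / sqrt k"
  let ?m = "num_paths \<alpha> n" and ?l = "path_length \<alpha> n"
  have n: "1 \<le> real n" using assms by simp
  have L: "L = 1 + ln (real n)" using n by (simp add: L_def ln_mult)
  have "1 \<le> L" using n by (simp add: L)
  have "1 \<le> q" using n assms by (simp add: q_def ge_one_powr_ge_zero)
  have p: "1 \<le> real n powr \<alpha>" using n assms by (simp add: ge_one_powr_ge_zero)
  \<comment> \<open>For \<open>x \<ge> 1\<close> the ceiling is at most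
    \<open>x + 1 \<le> 2 * x\<close>; the root adds one more vertex to a prefix, hence the factor 3
    for \<open>?l + 1\<close>.\<close>
  have m: "real ?m \<le> 2 * real n powr \<alpha>" using p unfolding num_paths_def by linarith
  have l: "real (?l + 1) \<le> 3 * q" using \<open>1 \<le> q\<close> unfolding path_length_def q_def[symmetric] by linarith
  have "card (vertices \<alpha> n) > 0" unfolding card_gt_0_iff by (simp add: vertices_eq)
  then have "0 < k" by (simp add: k_def)
  have "0 < c" using \<open>1 \<le> L\<close> \<open>1 \<le> q\<close> assms by (simp add: c_def)
  have "0 < \<delta>" using \<open>0 < k\<close> assms by (simp add: \<delta>_def)
  have "real (?m * (?l + 1)) \<le> (2 * real n powr \<alpha>) * (3 * q)"
    unfolding of_nat_mult using m l by (intro mult_mono) auto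
  also have "\<dots> = 6 * real n"
    using n by (simp add: q_def powr_add[symmetric])
  finally have "1 + real (?m * (?l + 1)) \<le> 7 * real n" using n by linarith
  then have "ln (1 + real (?m * (?l + 1))) \<le> ln (7 * real n)"
    using n by (subst ln_le_cancel_iff) (auto simp: add_pos_nonneg simp del: of_nat_add of_nat_mult)
  also have "\<dots> = ln 7 + ln (real n)" using n by (simp add: ln_mult)
  \<comment> \<open>Here \<open>7 \<le> 2 ^ 3\<close> and \<open>2 \<le> exp 1\<close>.\<close>
  also have "\<dots> \<le> ln (exp 1 ^ 3) + ln (real n)"
  proof -
    have "(2::real) ^ 3 \<le> exp 1 ^ 3" using exp_ge_add_one_self[of 1] by (intro power_mono) auto
    then show ?thesis by simp
  qed
  also have "\<dots> \<le> 3 * L" using n by (simp add: L ln_realpow)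
  finally have ln_le: "ln (1 + real (?m * (?l + 1))) \<le> 3 * L" .
  have c2: "c\<^sup>2 * \<sigma>\<^sup>2 = L / q" using \<open>1 \<le> L\<close> \<open>1 \<le> q\<close> assms by (simp add: c_def power_divide)
  have "c\<^sup>2 * \<sigma>\<^sup>2 * real (?l + 1) / 2 \<le> L / q * (3 * q) / 2"
    unfolding c2 using l \<open>1 \<le> L\<close> \<open>1 \<le> q\<close> by (intro divide_right_mono mult_left_mono) auto
  also have "\<dots> = 3 / 2 * L" using \<open>1 \<le> q\<close> by simp
  finally have var_le: "c\<^sup>2 * \<sigma>\<^sup>2 * real (?l + 1) / 2 \<le> 3 / 2 * L" .
  have "(ln (1 + real (?m * (?l + 1))) + c\<^sup>2 * \<sigma>\<^sup>2 * real (?l + 1) / 2) / c \<le> (9 / 2 * L) / c"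
    using ln_le var_le \<open>0 < c\<close> by (intro divide_right_mono) auto
  also have "L / c = \<sigma> * (sqrt L * sqrt q)"
    using \<open>1 \<le> L\<close> \<open>1 \<le> q\<close> assms by (simp add: c_def real_sqrt_divide field_simps)
  then have "(9 / 2 * L) / c = 9 / 2 * \<sigma> * (sqrt L * sqrt q)" by simp
  finally have dev: "2 * V * ((ln (1 + real (?m * (?l + 1))) + c\<^sup>2 * \<sigma>\<^sup>2 * real (?l + 1) / 2) / c)
      \<le> 2 * V * (9 / 2 * \<sigma> * (sqrt L * sqrt q))"
    using assms by (intro mult_left_mono) auto
  have "sqrt q = real n powr ((1 - \<alpha>) / 2)"
    using n by (simp add: q_def powr_half_sqrt[symmetric] powr_powr)
  moreover have "real n powr ((1 - \<alpha>) / 2) * real n powr ((1 + \<alpha>) / 2) = real n"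
    using n by (simp add: powr_add[symmetric] add_divide_distrib[symmetric])
  ultimately have q_n: "sqrt q / real n = 1 / real n powr ((1 + \<alpha>) / 2)"
    using n by (simp add: field_simps)
  have "(k * \<delta>\<^sup>2 + 2 * V * ((ln (1 + real (?m * (?l + 1))) + c\<^sup>2 * \<sigma>\<^sup>2 * real (?l + 1) / 2) / c)) / real n
      \<le> (\<sigma>\<^sup>2 + 2 * V * (9 / 2 * \<sigma> * (sqrt L * sqrt q))) / real n"
    using dev n \<open>0 < k\<close> by (intro divide_right_mono add_mono) (auto simp: \<delta>_def power_divide)
  also have "\<dots> = 9 * V * \<sigma> * (sqrt L * (sqrt q / real n)) + 1 * \<sigma>\<^sup>2 * (1 / real n)"
    by (simp add: add_divide_distrib)
  \<comment> \<open>The argument gives the constants 9 and 1, with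
    \<open>9 = 2 * (3 + 3 / 2)\<close> from the logarithmic and variance terms; they are relaxed to
    the stated ones.\<close>
  also have "\<dots> \<le> 21 * V * \<sigma> * (sqrt L * (sqrt q / real n)) + 16 * \<sigma>\<^sup>2 * ((1 + L) / real n)"
    using assms \<open>1 \<le> L\<close> \<open>1 \<le> q\<close>
    by (intro add_mono mult_mono divide_right_mono) auto
  finally have bound: "(k * \<delta>\<^sup>2
      + 2 * V * ((ln (1 + real (?m * (?l + 1))) + c\<^sup>2 * \<sigma>\<^sup>2 * real (?l + 1) / 2) / c)) / real n
      \<le> 21 * V * \<sigma> * (sqrt L / real n powr ((1 + \<alpha>) / 2)) + 16 * \<sigma>\<^sup>2 * ((1 + L) / real n)"
    unfolding q_n by simp
  show ?thesis
    using minimax_risk_le[OF \<open>n \<ge> 1\<close> \<open>V > 0\<close> \<open>\<sigma> > 0\<close> \<open>0 < c\<close> \<open>0 < \<delta>\<close>, of \<alpha>] ennreal_leI[OF bound]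
    unfolding k_def L_def by (rule order_trans)
qed

end
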